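(* Let $G$ be a group with a rotary pair $(a,z)$, and let $H=\langle a\rangle$ and $J=\langle z\rangle\cong\mathbb Z_2$. Then $\Gamma=\mathrm{Cos}(G,H,J)$ is a $G$-vertex-rotary graph of valency $k=|H:H\cap H^z|$ and edge-multiplicity $\lambda=|H\cap H^z|$, and $|a|=k\lambda$. Moreover, if $|a|\ge 3$ and $H\ne H^z$, then $\Gamma$ is neither $\mathbf K_2^{(\lambda)}$ nor a simple cycle.
   Context: A rotary pair for $G$ is $(a,z)$ with $G=\langle a,z\rangle$, $|a|$ finite, $|z|=2$, $z\notin\langle a\rangle$. $\mathrm{Cos}(G,H,J)$: vertex set $\{Hx:x\in G\}$, edge set $\{Jy:y\in G\}$, $Hx$ incident with $Jy$ iff $yx^{-1}\in JH$ (multiple edges allowed). A graph is $G$-vertex-rotary if $G$ is arc-transitive and each vertex stabiliser induces a transitive cyclic group on the edges incident with that vertex. $\mathbf K_2^{(\lambda)}$ is the graph with two vertices and $\lambda$ edges joining them; a simple cycle is a connected simple graph all of whose vertices have valency 2. *)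

theory Defs
  imports "HOL-Algebra.Algebra"
begin

text \<open>Multigraphs are given by a vertex set V, an edge set E and an incidence
  relation inc (inc v e: vertex v is incident with edge e); multiple edges allowed.\<close>

definition mg_adj :: "'v set \<Rightarrow> 'e set \<Rightarrow> ('v \<Rightarrow> 'e \<Rightarrow> bool) \<Rightarrow> 'v \<Rightarrow> 'v \<Rightarrow> bool" where
  "mg_adj V E inc u w \<longleftrightarrow> u \<in> V \<and> w \<in> V \<and> u \<noteq> w \<and> (\<exists>e\<in>E. inc u e \<and> inc w e)"

definition mg_edges_at :: "'e set \<Rightarrow> ('v \<Rightarrow> 'e \<Rightarrow> bool) \<Rightarrow> 'v \<Rightarrow> 'e set" where
  "mg_edges_at E inc v = {e \<in> E. inc v e}"

definition mg_ends :: "'v set \<Rightarrow> ('v \<Rightarrow> 'e \<Rightarrow> bool) \<Rightarrow> 'e \<Rightarrow> 'v set" where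
  "mg_ends V inc e = {v \<in> V. inc v e}"

definition mg_valency :: "'v set \<Rightarrow> 'e set \<Rightarrow> ('v \<Rightarrow> 'e \<Rightarrow> bool) \<Rightarrow> nat \<Rightarrow> bool" where
  "mg_valency V E inc k \<longleftrightarrow>
     (\<forall>v\<in>V. finite {w. mg_adj V E inc v w} \<and> card {w. mg_adj V E inc v w} = k)"

definition mg_edge_multiplicity :: "'v set \<Rightarrow> 'e set \<Rightarrow> ('v \<Rightarrow> 'e \<Rightarrow> bool) \<Rightarrow> nat \<Rightarrow> bool" where
  "mg_edge_multiplicity V E inc lam \<longleftrightarrow>
     (\<forall>u w. mg_adj V E inc u w \<longrightarrow>
        finite {e\<in>E. inc u e \<and> inc w e} \<and> card {e\<in>E. inc u e \<and> inc w e} = lam)"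

definition is_K2_mult :: "'v set \<Rightarrow> 'e set \<Rightarrow> ('v \<Rightarrow> 'e \<Rightarrow> bool) \<Rightarrow> nat \<Rightarrow> bool" where
  "is_K2_mult V E inc lam \<longleftrightarrow>
     (\<exists>u w. u \<noteq> w \<and> V = {u, w} \<and> finite E \<and> card E = lam \<and>
        (\<forall>e\<in>E. mg_ends V inc e = {u, w}))"

definition mg_simple :: "'v set \<Rightarrow> 'e set \<Rightarrow> ('v \<Rightarrow> 'e \<Rightarrow> bool) \<Rightarrow> bool" where
  "mg_simple V E inc \<longleftrightarrow>
     (\<forall>e\<in>E. finite (mg_ends V inc e) \<and> card (mg_ends V inc e) = 2) \<and>
     (\<forall>e\<in>E. \<forall>e'\<in>E. mg_ends V inc e = mg_ends V inc e' \<longrightarrow> e = e')"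

definition mg_connected :: "'v set \<Rightarrow> 'e set \<Rightarrow> ('v \<Rightarrow> 'e \<Rightarrow> bool) \<Rightarrow> bool" where
  "mg_connected V E inc \<longleftrightarrow> V \<noteq> {} \<and> (\<forall>u\<in>V. \<forall>w\<in>V. (mg_adj V E inc)\<^sup>*\<^sup>* u w)"

definition is_simple_cycle :: "'v set \<Rightarrow> 'e set \<Rightarrow> ('v \<Rightarrow> 'e \<Rightarrow> bool) \<Rightarrow> bool" where
  "is_simple_cycle V E inc \<longleftrightarrow>
     mg_simple V E inc \<and> mg_connected V E inc \<and> mg_valency V E inc 2"

text \<open>G acts (on the right) on the multigraph by automorphisms via actV, actE;
  G-vertex-rotary: G is arc-transitive (transitive on vertices and on incident
  vertex-edge pairs) and each vertex stabiliser induces a transitive cyclic group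
  on the edges incident with that vertex.\<close>
definition vertex_rotary ::
  "('g, 'b) monoid_scheme \<Rightarrow> 'v set \<Rightarrow> 'e set \<Rightarrow> ('v \<Rightarrow> 'e \<Rightarrow> bool)
     \<Rightarrow> ('v \<Rightarrow> 'g \<Rightarrow> 'v) \<Rightarrow> ('e \<Rightarrow> 'g \<Rightarrow> 'e) \<Rightarrow> bool" where
  "vertex_rotary G V E inc actV actE \<longleftrightarrow>
     \<comment> \<open>right action by automorphisms\<close>
     (\<forall>v\<in>V. \<forall>g\<in>carrier G. actV v g \<in> V) \<and>
     (\<forall>e\<in>E. \<forall>g\<in>carrier G. actE e g \<in> E) \<and>
     (\<forall>v\<in>V. actV v \<one>\<^bsub>G\<^esub> = v) \<and>
     (\<forall>e\<in>E. actE e \<one>\<^bsub>G\<^esub> = e) \<and>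
     (\<forall>v\<in>V. \<forall>g\<in>carrier G. \<forall>h\<in>carrier G. actV v (g \<otimes>\<^bsub>G\<^esub> h) = actV (actV v g) h) \<and>
     (\<forall>e\<in>E. \<forall>g\<in>carrier G. \<forall>h\<in>carrier G. actE e (g \<otimes>\<^bsub>G\<^esub> h) = actE (actE e g) h) \<and>
     (\<forall>v\<in>V. \<forall>e\<in>E. \<forall>g\<in>carrier G. inc v e \<longleftrightarrow> inc (actV v g) (actE e g)) \<and>
     \<comment> \<open>arc-transitivity\<close>
     (\<forall>v\<in>V. \<forall>v'\<in>V. \<exists>g\<in>carrier G. actV v g = v') \<and>
     (\<forall>v\<in>V. \<forall>e\<in>E. \<forall>v'\<in>V. \<forall>e'\<in>E. inc v e \<longrightarrow> inc v' e' \<longrightarrow>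
        (\<exists>g\<in>carrier G. actV v g = v' \<and> actE e g = e')) \<and>
     \<comment> \<open>stabilisers induce transitive cyclic groups on incident edges\<close>
     (\<forall>v\<in>V.
        (\<forall>e\<in>mg_edges_at E inc v. \<forall>e'\<in>mg_edges_at E inc v.
            \<exists>g\<in>carrier G. actV v g = v \<and> actE e g = e') \<and>
        (\<exists>c\<in>carrier G. actV v c = v \<and>
            (\<forall>g\<in>carrier G. actV v g = v \<longrightarrow>
               (\<exists>n::int. \<forall>e\<in>mg_edges_at E inc v. actE e g = actE e (c [^]\<^bsub>G\<^esub> n)))))"

text \<open>Coset graph Cos(G,H,J): vertices the right cosets Hx, edges the right cosets Jy,
  Hx incident with Jy iff y x^-1 \<in> JH.\<close>
definition cos_inc :: "('g, 'b) monoid_scheme \<Rightarrow> 'g set \<Rightarrow> 'g set \<Rightarrow> 'g set \<Rightarrow> 'g set \<Rightarrow> bool" where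
  "cos_inc G H J A B \<longleftrightarrow>
     (\<exists>x\<in>carrier G. \<exists>y\<in>carrier G. A = r_coset G H x \<and> B = r_coset G J y \<and>
        monoid.mult G y (m_inv G x) \<in> set_mult G J H)"

end

theory Submission
  imports Defs
begin

(* Since J = {1, z}, the edge Jy of Cos(G,H,J) is incident exactly with Hy and Hzy, and every
   flag can be written (Hy, Jy); hence G, acting by right multiplication, is flag-transitive, and
   the stabiliser of Hx is the cyclic group x^-1 H x.  The neighbours of Hx are the cosets Hzhx
   (h in H), and Hzhx = Hzh'x iff h h'^-1 lies in K = H \<inter> H^z, so the valency is |H:K|;
   the edges joining Hx to Hzhx are the J(sx) with s in Kh, so the multiplicity is |K|, and
   |a| = |H| = |H:K| |K|.  If there were only two vertices, all Hzh would coincide, forcing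
   zHz \<subseteq> H, i.e. H^z = H; a simple cycle has |H:K| = 2 and |K| = 1, i.e. |a| = 2. *)

lemma card_image_eq_if_same_fibres:
  assumes "\<And>x y. x \<in> S \<Longrightarrow> y \<in> S \<Longrightarrow> f x = f y \<longleftrightarrow> g x = g y"
  shows "card (f ` S) = card (g ` S)"
proof -
  define p where "p = (\<lambda>u. g (inv_into S f u))"
  have p_f: "p (f x) = g x" if "x \<in> S" for x
    unfolding p_def using assms that by (metis f_inv_into_f image_eqI inv_into_into)
  have "inj_on p (f ` S)" using p_f assms by (auto simp: inj_on_def)
  moreover have "p ` f ` S = g ` S" using p_f by (auto simp: image_iff)
  ultimately show ?thesis by (metis card_image)
qed

lemma mg_simple_common_edges_card_le_1:
  assumes simple: "mg_simple V E inc" and "u \<in> V" "w \<in> V" "u \<noteq> w"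
  shows "card {e \<in> E. inc u e \<and> inc w e} \<le> 1"
proof -
  let ?S = "{e \<in> E. inc u e \<and> inc w e}"
  have ends: "mg_ends V inc e = {u, w}" if "e \<in> ?S" for e
  proof -
    have "finite (mg_ends V inc e)" "card (mg_ends V inc e) = 2"
      using simple that unfolding mg_simple_def by auto
    moreover have "{u, w} \<subseteq> mg_ends V inc e" using assms that unfolding mg_ends_def by auto
    moreover have "card {u, w} = 2" using \<open>u \<noteq> w\<close> by simp
    ultimately show ?thesis using card_subset_eq by metis
  qed
  have unique: "e = e'" if "e \<in> ?S" "e' \<in> ?S" for e e'
    using simple ends[OF that(1)] ends[OF that(2)] that unfolding mg_simple_def by auto
  show ?thesis
  proof (cases "?S = {}")
    case False
    then obtain e where "e \<in> ?S" by blast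
    then have "?S = {e}" using unique by blast
    then show ?thesis by simp
  next
    case True
    then show ?thesis unfolding True by simp
  qed
qed

context group
begin

lemma m_inv_cancel_left [simp]: "x \<in> carrier G \<Longrightarrow> y \<in> carrier G \<Longrightarrow> x \<otimes> (inv x \<otimes> y) = y"
  by (simp add: m_assoc[symmetric])

lemma inv_m_cancel_left [simp]: "x \<in> carrier G \<Longrightarrow> y \<in> carrier G \<Longrightarrow> inv x \<otimes> (x \<otimes> y) = y"
  by (simp add: m_assoc[symmetric])

lemma rcos_eq_iff:
  assumes "subgroup S G" "x \<in> carrier G" "y \<in> carrier G"
  shows "S #> x = S #> y \<longleftrightarrow> x \<otimes> inv y \<in> S"
  by (metis assms is_group rcos_self repr_independence subgroup.rcos_module)

lemma rcoset_mult_cancel: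
  assumes "A \<subseteq> carrier G" "B \<subseteq> carrier G" "g \<in> carrier G"
  shows "A #> g = B #> g \<longleftrightarrow> A = B"
  by (metis assms coset_mult_assoc coset_mult_one inv_closed r_inv)

lemma rcosets_mult_closed:
  assumes "subgroup S G" "A \<in> rcosets S" "g \<in> carrier G"
  shows "A #> g \<in> rcosets S"
  using assms by (auto simp: RCOSETS_def coset_mult_assoc subgroup.subset)

lemma conj_hom: "x \<in> carrier G \<Longrightarrow> (\<lambda>y. inv x \<otimes> y \<otimes> x) \<in> hom G G"
  unfolding hom_def by (auto simp: m_assoc)

lemma subgroup_conj:
  assumes "subgroup S G" "x \<in> carrier G"
  shows "subgroup (inv x <#\<^bsub>G\<^esub> (S #> x)) G"
proof -
  have "inv x <#\<^bsub>G\<^esub> (S #> x) = (\<lambda>y. inv x \<otimes> y \<otimes> x) ` S"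
    using assms by (auto simp: l_coset_def r_coset_def m_assoc subgroup.mem_carrier)
  moreover have "group_hom G G (\<lambda>y. inv x \<otimes> y \<otimes> x)"
    using conj_hom[OF assms(2)] by (simp add: group_hom_def group_hom_axioms_def is_group)
  ultimately show ?thesis using group_hom.subgroup_img_is_subgroup assms(1) by fastforce
qed

lemma generate_involution:
  assumes "z \<in> carrier G" "z \<otimes> z = \<one>"
  shows "generate G {z} = {\<one>, z}"
proof
  have "inv z = z" using assms by (simp add: inv_equality)
  show "generate G {z} \<subseteq> {\<one>, z}"
  proof
    fix x assume "x \<in> generate G {z}"
    then show "x \<in> {\<one>, z}"
      by (induction rule: generate.induct) (use assms \<open>inv z = z\<close> in auto)
  qed
  show "{\<one>, z} \<subseteq> generate G {z}" by (simp add: generate.one generate.incl)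
qed

lemma card_rcosets_in_subgroup:
  assumes "subgroup K G" "subgroup H G" "K \<subseteq> H"
  shows "card ((\<lambda>h. K #> h) ` H) * card K = card H"
proof -
  interpret H: group "G\<lparr>carrier := H\<rparr>"
    using assms(2) by (rule subgroup.subgroup_is_group) (rule is_group)
  have "card (rcosets\<^bsub>G\<lparr>carrier := H\<rparr>\<^esub> K) * card K = order (G\<lparr>carrier := H\<rparr>)"
    using H.lagrange subgroup_incl[OF assms] by blast
  moreover have "rcosets\<^bsub>G\<lparr>carrier := H\<rparr>\<^esub> K = (\<lambda>h. K #> h) ` H"
    by (auto simp: RCOSETS_def r_coset_def)
  ultimately show ?thesis by (simp add: order_def)
qed

end

locale involution_coset_graph = group G for G (structure) +
  fixes H :: "'a set" and z :: 'a
  assumes subgroup_H: "subgroup H G"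
    and z_carrier: "z \<in> carrier G"
    and z_involution: "z \<otimes> z = \<one>"
    and z_notin_H: "z \<notin> H"
begin

abbreviation J :: "'a set" where "J \<equiv> generate G {z}"
abbreviation Hz :: "'a set" where "Hz \<equiv> inv z <#\<^bsub>G\<^esub> (H #> z)"
abbreviation K :: "'a set" where "K \<equiv> H \<inter> Hz"
abbreviation V :: "'a set set" where "V \<equiv> rcosets H"
abbreviation E :: "'a set set" where "E \<equiv> rcosets J"
abbreviation inc :: "'a set \<Rightarrow> 'a set \<Rightarrow> bool" where "inc \<equiv> cos_inc G H J"

lemmas H_carrier = subgroup.mem_carrier[OF subgroup_H]
lemmas H_m_closed = subgroup.m_closed[OF subgroup_H]
lemmas H_inv_closed = subgroup.m_inv_closed[OF subgroup_H]

lemma inv_z: "inv z = z"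
  using z_carrier z_involution by (simp add: inv_equality)

lemma z_z_mult: "x \<in> carrier G \<Longrightarrow> z \<otimes> (z \<otimes> x) = x"
  using z_carrier z_involution by (simp add: m_assoc[symmetric])

lemma J_eq: "J = {\<one>, z}"
  by (rule generate_involution[OF z_carrier z_involution])

lemma subgroup_J: "subgroup J G"
  using z_carrier by (simp add: generate_is_subgroup)

lemma subgroup_K: "subgroup K G"
  using subgroups_Inter_pair subgroup_H subgroup_conj[OF subgroup_H z_carrier] z_carrier by blast

lemma Hz_eq: "Hz = (\<lambda>h. z \<otimes> h \<otimes> z) ` H"
  by (auto simp: l_coset_def r_coset_def m_assoc inv_z H_carrier z_carrier)

lemma Hz_eq_H_if_conj_closed:
  assumes "\<And>h. h \<in> H \<Longrightarrow> z \<otimes> h \<otimes> z \<in> H"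
  shows "Hz = H"
proof
  show "Hz \<subseteq> H" using assms by (auto simp: Hz_eq)
  show "H \<subseteq> Hz"
  proof
    fix h assume "h \<in> H"
    then have "h = z \<otimes> (z \<otimes> h \<otimes> z) \<otimes> z"
      using z_carrier H_carrier z_involution by (simp add: m_assoc z_z_mult)
    then show "h \<in> Hz" using assms \<open>h \<in> H\<close> by (auto simp: Hz_eq)
  qed
qed

lemma rcoset_z_mult_neq: "y \<in> carrier G \<Longrightarrow> H #> (z \<otimes> y) \<noteq> H #> y"
  using rcos_eq_iff[OF subgroup_H] z_notin_H z_carrier by (simp add: m_assoc)

lemma J_rcoset: "y \<in> carrier G \<Longrightarrow> J #> y = {y, z \<otimes> y}"
  by (auto simp: r_coset_def J_eq)

lemma J_rcoset_z_mult: "y \<in> carrier G \<Longrightarrow> J #> (z \<otimes> y) = J #> y"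
  using rcos_eq_iff[OF subgroup_J] z_carrier J_eq by (simp add: m_assoc)

lemma mem_Hz_iff: "t \<in> carrier G \<Longrightarrow> t \<in> Hz \<longleftrightarrow> z \<otimes> t \<otimes> z \<in> H"
proof -
  assume t: "t \<in> carrier G"
  have "t = z \<otimes> (z \<otimes> t \<otimes> z) \<otimes> z"
    using t z_carrier z_involution by (simp add: m_assoc z_z_mult)
  moreover have "z \<otimes> (z \<otimes> h \<otimes> z) \<otimes> z = h" if "h \<in> H" for h
    using that H_carrier z_carrier z_involution by (simp add: m_assoc z_z_mult)
  ultimately show ?thesis by (auto simp: Hz_eq image_iff)
qed

lemma rcoset_H_mult: "s \<in> H \<Longrightarrow> x \<in> carrier G \<Longrightarrow> H #> (s \<otimes> x) = H #> x"
  by (metis H_carrier coset_mult_assoc is_group subgroup.rcos_const subgroup.subset subgroup_H)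

lemma mult_inv_in_JH_iff:
  assumes x: "x \<in> carrier G" and y: "y \<in> carrier G"
  shows "y \<otimes> inv x \<in> J <#> H \<longleftrightarrow> H #> y = H #> x \<or> H #> (z \<otimes> y) = H #> x"
proof -
  have "J <#> H = H \<union> (\<lambda>h. z \<otimes> h) ` H"
    by (auto simp: set_mult_def J_eq H_carrier)
  moreover have "y \<otimes> inv x \<in> (\<lambda>h. z \<otimes> h) ` H \<longleftrightarrow> z \<otimes> y \<otimes> inv x \<in> H"
    using x y z_carrier H_carrier z_z_mult[of "y \<otimes> inv x"] by (force simp: m_assoc z_z_mult)
  ultimately show ?thesis
    using rcos_eq_iff[OF subgroup_H y x] rcos_eq_iff[OF subgroup_H _ x, of "z \<otimes> y"] y z_carrier
    by auto
qed

lemma cos_inc_iff: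
  assumes y: "y \<in> carrier G"
  shows "inc A (J #> y) \<longleftrightarrow> A = H #> y \<or> A = H #> (z \<otimes> y)"
proof
  assume "inc A (J #> y)"
  then obtain x y' where x: "x \<in> carrier G" and y': "y' \<in> carrier G" and "A = H #> x"
    and "J #> y = J #> y'" and "y' \<otimes> inv x \<in> J <#> H"
    unfolding cos_inc_def by blast
  then have A: "H #> y' = A \<or> H #> (z \<otimes> y') = A"
    using mult_inv_in_JH_iff[OF x y'] by simp
  have "y' \<in> J #> y" using rcos_self[OF y' subgroup_J] \<open>J #> y = J #> y'\<close> by simp
  then have "y' = y \<or> y' = z \<otimes> y" using J_rcoset[OF y] by simp
  then show "A = H #> y \<or> A = H #> (z \<otimes> y)"
    using A y z_z_mult by auto
next
  assume A: "A = H #> y \<or> A = H #> (z \<otimes> y)"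
  have "y \<otimes> inv x \<in> J <#> H" if "x = y \<or> x = z \<otimes> y" for x
    using mult_inv_in_JH_iff that y z_carrier by auto
  then show "inc A (J #> y)"
    unfolding cos_inc_def using A y z_carrier by blast
qed

lemma flag_normal_form:
  assumes "e \<in> E" "inc v e"
  shows "\<exists>y\<in>carrier G. v = H #> y \<and> e = J #> y"
proof -
  obtain y where y: "y \<in> carrier G" and e: "e = J #> y"
    using assms(1) by (auto simp: RCOSETS_def)
  then have "v = H #> y \<or> v = H #> (z \<otimes> y)" using assms(2) cos_inc_iff by simp
  then show ?thesis using J_rcoset_z_mult y e z_carrier by (metis m_closed)
qed

lemma edges_at_vertex:
  assumes x: "x \<in> carrier G"
  shows "mg_edges_at E inc (H #> x) = (\<lambda>s. J #> (s \<otimes> x)) ` H"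
proof
  show "mg_edges_at E inc (H #> x) \<subseteq> (\<lambda>s. J #> (s \<otimes> x)) ` H"
  proof
    fix e assume "e \<in> mg_edges_at E inc (H #> x)"
    then obtain y where y: "y \<in> carrier G" "H #> x = H #> y" "e = J #> y"
      using flag_normal_form by (auto simp: mg_edges_at_def)
    then have "y \<otimes> inv x \<in> H" and "y = (y \<otimes> inv x) \<otimes> x"
      using rcos_eq_iff[OF subgroup_H y(1) x] x by (auto simp: m_assoc)
    then show "e \<in> (\<lambda>s. J #> (s \<otimes> x)) ` H" using y(3) by (metis image_eqI)
  qed
  show "(\<lambda>s. J #> (s \<otimes> x)) ` H \<subseteq> mg_edges_at E inc (H #> x)"
  proof clarify
    fix s assume s: "s \<in> H"
    then have "J #> (s \<otimes> x) \<in> E" and "inc (H #> x) (J #> (s \<otimes> x))"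
      using x H_carrier cos_inc_iff rcoset_H_mult[OF s x] rcosetsI[OF subgroup.subset[OF subgroup_J]]
      by auto
    then show "J #> (s \<otimes> x) \<in> mg_edges_at E inc (H #> x)" by (simp add: mg_edges_at_def)
  qed
qed

lemma inj_on_edges_at_vertex:
  assumes x: "x \<in> carrier G"
  shows "inj_on (\<lambda>s. J #> (s \<otimes> x)) H"
proof
  fix s t assume s: "s \<in> H" and t: "t \<in> H" and "J #> (s \<otimes> x) = J #> (t \<otimes> x)"
  moreover have "(s \<otimes> x) \<otimes> inv (t \<otimes> x) = s \<otimes> inv t"
    using s t x H_carrier by (simp add: m_assoc inv_mult_group)
  ultimately have "s \<otimes> inv t \<in> J"
    using rcos_eq_iff[OF subgroup_J, of "s \<otimes> x" "t \<otimes> x"] x H_carrier by simp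
  moreover have "s \<otimes> inv t \<in> H" using s t H_m_closed H_inv_closed by blast
  ultimately have "s \<otimes> inv t = \<one>" using J_eq z_notin_H by auto
  then show "s = t" using inv_solve_right'[of \<one> s t] s t H_carrier by simp
qed

lemma rcoset_neighbour_neq: "h \<in> H \<Longrightarrow> x \<in> carrier G \<Longrightarrow> H #> (z \<otimes> h \<otimes> x) \<noteq> H #> x"
  using rcoset_z_mult_neq[of "h \<otimes> x"] rcoset_H_mult[of h x] H_carrier z_carrier by (simp add: m_assoc)

lemma cos_inc_edge_at_vertex:
  assumes s: "s \<in> H" and x: "x \<in> carrier G"
  shows "inc w (J #> (s \<otimes> x)) \<longleftrightarrow> w = H #> x \<or> w = H #> (z \<otimes> s \<otimes> x)"
proof -
  have "s \<otimes> x \<in> carrier G" using s x H_carrier by simp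
  then show ?thesis
    using cos_inc_iff[of "s \<otimes> x" w] rcoset_H_mult[OF s x] s x H_carrier z_carrier by (simp add: m_assoc)
qed

lemma adj_iff:
  assumes x: "x \<in> carrier G"
  shows "mg_adj V E inc (H #> x) w \<longleftrightarrow> (\<exists>h\<in>H. w = H #> (z \<otimes> h \<otimes> x))"
proof -
  have "(\<exists>e\<in>E. inc (H #> x) e \<and> inc w e) \<longleftrightarrow> (\<exists>e\<in>mg_edges_at E inc (H #> x). inc w e)"
    unfolding mg_edges_at_def by blast
  also have "\<dots> \<longleftrightarrow> (\<exists>s\<in>H. w = H #> x \<or> w = H #> (z \<otimes> s \<otimes> x))"
    unfolding edges_at_vertex[OF x] using cos_inc_edge_at_vertex[OF _ x] by simp
  finally have edge: "(\<exists>e\<in>E. inc (H #> x) e \<and> inc w e) \<longleftrightarrow>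
      (\<exists>s\<in>H. w = H #> x \<or> w = H #> (z \<otimes> s \<otimes> x))" .
  have V: "H #> y \<in> V" if "y \<in> carrier G" for y
    using rcosetsI[OF subgroup.subset[OF subgroup_H] that] .
  show ?thesis
  proof
    assume "mg_adj V E inc (H #> x) w"
    then show "\<exists>h\<in>H. w = H #> (z \<otimes> h \<otimes> x)" unfolding mg_adj_def edge by blast
  next
    assume "\<exists>h\<in>H. w = H #> (z \<otimes> h \<otimes> x)"
    then obtain h where h: "h \<in> H" and w: "w = H #> (z \<otimes> h \<otimes> x)" by blast
    then show "mg_adj V E inc (H #> x) w"
      unfolding mg_adj_def edge
      using rcoset_neighbour_neq[OF h x] V x H_carrier[OF h] z_carrier by auto
  qed
qed

lemma neighbour_eq_iff:
  assumes x: "x \<in> carrier G" and h: "h \<in> H" and h': "h' \<in> H"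
  shows "H #> (z \<otimes> h \<otimes> x) = H #> (z \<otimes> h' \<otimes> x) \<longleftrightarrow> K #> h = K #> h'"
proof -
  have hc: "h \<in> carrier G" "h' \<in> carrier G" using h h' H_carrier by auto
  have "(z \<otimes> h \<otimes> x) \<otimes> inv (z \<otimes> h' \<otimes> x) = z \<otimes> (h \<otimes> inv h') \<otimes> z"
    using hc x z_carrier by (simp add: m_assoc inv_mult_group inv_z)
  then have "H #> (z \<otimes> h \<otimes> x) = H #> (z \<otimes> h' \<otimes> x) \<longleftrightarrow> h \<otimes> inv h' \<in> Hz"
    using rcos_eq_iff[OF subgroup_H, of "z \<otimes> h \<otimes> x" "z \<otimes> h' \<otimes> x"] mem_Hz_iff[of "h \<otimes> inv h'"]
      hc x z_carrier by simp
  also have "\<dots> \<longleftrightarrow> h \<otimes> inv h' \<in> K" using H_m_closed[OF h H_inv_closed[OF h']] by blast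
  also have "\<dots> \<longleftrightarrow> K #> h = K #> h'" using rcos_eq_iff[OF subgroup_K] hc by simp
  finally show ?thesis .
qed

lemma neighbours_eq:
  assumes "x \<in> carrier G"
  shows "{w. mg_adj V E inc (H #> x) w} = (\<lambda>h. H #> (z \<otimes> h \<otimes> x)) ` H"
  using adj_iff[OF assms] by auto

lemma card_neighbours:
  assumes x: "x \<in> carrier G"
  shows "card {w. mg_adj V E inc (H #> x) w} = card ((\<lambda>h. K #> h) ` H)"
  unfolding neighbours_eq[OF x]
  by (rule card_image_eq_if_same_fibres) (use neighbour_eq_iff[OF x] in blast)

lemma valency:
  assumes "finite H"
  shows "mg_valency V E inc (card ((\<lambda>h. K #> h) ` H))"
  unfolding mg_valency_def
proof
  fix v assume "v \<in> V"
  then obtain x where x: "x \<in> carrier G" and v: "v = H #> x" by (auto simp: RCOSETS_def)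
  show "finite {w. mg_adj V E inc v w} \<and> card {w. mg_adj V E inc v w} = card ((\<lambda>h. K #> h) ` H)"
    using assms neighbours_eq[OF x] card_neighbours[OF x] v by simp
qed

lemma common_edges_eq:
  assumes x: "x \<in> carrier G" and h: "h \<in> H"
  shows "{e \<in> E. inc (H #> x) e \<and> inc (H #> (z \<otimes> h \<otimes> x)) e} = (\<lambda>s. J #> (s \<otimes> x)) ` (K #> h)"
proof -
  have hc: "h \<in> carrier G" using h H_carrier by simp
  have KhH: "K #> h \<subseteq> H" using h H_m_closed by (auto simp: r_coset_def)
  have "{s \<in> H. inc (H #> (z \<otimes> h \<otimes> x)) (J #> (s \<otimes> x))} = {s \<in> H. K #> h = K #> s}"
    using cos_inc_edge_at_vertex[OF _ x] rcoset_neighbour_neq[OF h x] neighbour_eq_iff[OF x h] by auto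
  also have "\<dots> = K #> h"
    using KhH rcos_eq_iff[OF subgroup_K _ hc] subgroup.rcos_module[OF subgroup_K is_group hc]
      H_carrier by blast
  finally have eq: "{s \<in> H. inc (H #> (z \<otimes> h \<otimes> x)) (J #> (s \<otimes> x))} = K #> h" .
  have "{e \<in> E. inc (H #> x) e \<and> inc (H #> (z \<otimes> h \<otimes> x)) e}
      = {e \<in> mg_edges_at E inc (H #> x). inc (H #> (z \<otimes> h \<otimes> x)) e}"
    unfolding mg_edges_at_def by blast
  also have "\<dots> = (\<lambda>s. J #> (s \<otimes> x)) ` {s \<in> H. inc (H #> (z \<otimes> h \<otimes> x)) (J #> (s \<otimes> x))}"
    unfolding edges_at_vertex[OF x] by blast
  finally show ?thesis unfolding eq .
qed

lemma edge_multiplicity: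
  assumes "finite H"
  shows "mg_edge_multiplicity V E inc (card K)"
  unfolding mg_edge_multiplicity_def
proof (intro allI impI)
  fix u w assume adj: "mg_adj V E inc u w"
  then obtain x where x: "x \<in> carrier G" and u: "u = H #> x"
    by (auto simp: mg_adj_def RCOSETS_def)
  then obtain h where h: "h \<in> H" and w: "w = H #> (z \<otimes> h \<otimes> x)"
    using adj adj_iff by blast
  have KhH: "K #> h \<subseteq> H" using h H_m_closed by (auto simp: r_coset_def)
  have "card ((\<lambda>s. J #> (s \<otimes> x)) ` (K #> h)) = card (K #> h)"
    using card_image inj_on_subset[OF inj_on_edges_at_vertex[OF x] KhH] by blast
  also have "\<dots> = card K"
    using card_rcosets_equal[of "K #> h" K] rcosetsI subgroup.subset[OF subgroup_K] H_carrier[OF h]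
    by auto
  finally show "finite {e \<in> E. inc u e \<and> inc w e} \<and> card {e \<in> E. inc u e \<and> inc w e} = card K"
    using common_edges_eq[OF x h] u w finite_imageI[OF finite_subset[OF KhH assms]] by simp
qed

lemma card_H_eq_index_times_card_K: "card H = card ((\<lambda>h. K #> h) ` H) * card K"
  using card_rcosets_in_subgroup[OF subgroup_K subgroup_H] by auto

lemma stabiliser_iff:
  assumes "x \<in> carrier G" "g \<in> carrier G"
  shows "(H #> x) #> g = H #> x \<longleftrightarrow> x \<otimes> g \<otimes> inv x \<in> H"
  using assms rcos_eq_iff[OF subgroup_H, of "x \<otimes> g" x]
  by (simp add: coset_mult_assoc subgroup.subset[OF subgroup_H])

lemma cos_inc_mult_iff:
  assumes v: "v \<in> V" and e: "e \<in> E" and g: "g \<in> carrier G"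
  shows "inc (v #> g) (e #> g) \<longleftrightarrow> inc v e"
proof -
  obtain y where y: "y \<in> carrier G" and ey: "e = J #> y" using e by (auto simp: RCOSETS_def)
  have v_sub: "v \<subseteq> carrier G" using subgroup.rcosets_carrier[OF subgroup_H is_group v] .
  have H_sub: "H \<subseteq> carrier G" using subgroup.subset[OF subgroup_H] .
  have "e #> g = J #> (y \<otimes> g)"
    using ey y g coset_mult_assoc subgroup.subset[OF subgroup_J] by simp
  then have "inc (v #> g) (e #> g) \<longleftrightarrow> v #> g = (H #> y) #> g \<or> v #> g = (H #> (z \<otimes> y)) #> g"
    using cos_inc_iff y g z_carrier coset_mult_assoc[OF H_sub] by (simp add: m_assoc)
  also have "\<dots> \<longleftrightarrow> v = H #> y \<or> v = H #> (z \<otimes> y)"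
    using rcoset_mult_cancel v_sub r_coset_subset_G[OF H_sub] y g z_carrier by simp
  also have "\<dots> \<longleftrightarrow> inc v e" using cos_inc_iff y ey by simp
  finally show ?thesis .
qed

lemma flag_transitive:
  assumes "e \<in> E" "inc v e" "e' \<in> E" "inc v' e'"
  shows "\<exists>g\<in>carrier G. v #> g = v' \<and> e #> g = e'"
proof -
  obtain y y' where y: "y \<in> carrier G" "y' \<in> carrier G"
    and flags: "v = H #> y" "e = J #> y" "v' = H #> y'" "e' = J #> y'"
    using flag_normal_form assms by metis
  have "v #> (inv y \<otimes> y') = v' \<and> e #> (inv y \<otimes> y') = e'"
    using flags y coset_mult_assoc subgroup.subset[OF subgroup_H] subgroup.subset[OF subgroup_J]
    by simp
  then show ?thesis using y by blast
qed

lemma vertex_stabiliser_cyclic: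
  assumes a: "a \<in> carrier G" and H_eq: "H = generate G {a}" and v: "v \<in> V"
  shows "\<exists>c\<in>carrier G. v #> c = v \<and> (\<forall>g\<in>carrier G. v #> g = v \<longrightarrow> (\<exists>n::int. g = c [^] n))"
proof -
  obtain x where x: "x \<in> carrier G" and vx: "v = H #> x" using v by (auto simp: RCOSETS_def)
  define c where "c = inv x \<otimes> a \<otimes> x"
  have c: "c \<in> carrier G" unfolding c_def using x a by simp
  have "x \<otimes> c \<otimes> inv x = a" unfolding c_def using x a by (simp add: m_assoc)
  then have "v #> c = v"
    using stabiliser_iff[OF x c] vx H_eq generate.incl[of a "{a}" G] by simp
  moreover have "\<exists>n::int. g = c [^] n" if g: "g \<in> carrier G" and "v #> g = v" for g
  proof -
    have "x \<otimes> g \<otimes> inv x \<in> generate G {a}" using stabiliser_iff[OF x g] \<open>v #> g = v\<close> vx H_eq by simp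
    then obtain n :: int where n: "x \<otimes> g \<otimes> inv x = a [^] n" using generate_pow[OF a] by blast
    have "g = inv x \<otimes> (x \<otimes> g \<otimes> inv x) \<otimes> x" using x g by (simp add: m_assoc)
    also have "\<dots> = c [^] n"
      unfolding n c_def using hom_int_pow[OF conj_hom[OF x] a is_group is_group] by simp
    finally show ?thesis ..
  qed
  ultimately show ?thesis using c by blast
qed

lemma vertex_transitive:
  assumes "v \<in> V" "v' \<in> V"
  shows "\<exists>g\<in>carrier G. v #> g = v'"
proof -
  obtain x x' where x: "x \<in> carrier G" "x' \<in> carrier G" and "v = H #> x" "v' = H #> x'"
    using assms by (auto simp: RCOSETS_def)
  then have "v #> (inv x \<otimes> x') = v'"
    using coset_mult_assoc subgroup.subset[OF subgroup_H] by simp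
  then show ?thesis using x by blast
qed

lemma vertex_rotary_cos_graph:
  assumes "a \<in> carrier G" "H = generate G {a}"
  shows "vertex_rotary G V E inc (\<lambda>S g. S #> g) (\<lambda>T g. T #> g)"
  unfolding vertex_rotary_def
proof (intro conjI)
  have V_sub: "v \<subseteq> carrier G" if "v \<in> V" for v
    using subgroup.rcosets_carrier[OF subgroup_H is_group that] .
  have E_sub: "e \<subseteq> carrier G" if "e \<in> E" for e
    using subgroup.rcosets_carrier[OF subgroup_J is_group that] .
  show "\<forall>v\<in>V. \<forall>g\<in>carrier G. v #> g \<in> V" using rcosets_mult_closed[OF subgroup_H] by blast
  show "\<forall>e\<in>E. \<forall>g\<in>carrier G. e #> g \<in> E" using rcosets_mult_closed[OF subgroup_J] by blast
  show "\<forall>v\<in>V. v #> \<one> = v" using V_sub by simp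
  show "\<forall>e\<in>E. e #> \<one> = e" using E_sub by simp
  show "\<forall>v\<in>V. \<forall>g\<in>carrier G. \<forall>h\<in>carrier G. v #> (g \<otimes> h) = v #> g #> h"
    using V_sub coset_mult_assoc by simp
  show "\<forall>e\<in>E. \<forall>g\<in>carrier G. \<forall>h\<in>carrier G. e #> (g \<otimes> h) = e #> g #> h"
    using E_sub coset_mult_assoc by simp
  show "\<forall>v\<in>V. \<forall>e\<in>E. \<forall>g\<in>carrier G. inc v e = inc (v #> g) (e #> g)"
    using cos_inc_mult_iff by simp
  show "\<forall>v\<in>V. \<forall>v'\<in>V. \<exists>g\<in>carrier G. v #> g = v'" using vertex_transitive by blast
  show "\<forall>v\<in>V. \<forall>e\<in>E. \<forall>v'\<in>V. \<forall>e'\<in>E. inc v e \<longrightarrow> inc v' e' \<longrightarrow>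
      (\<exists>g\<in>carrier G. v #> g = v' \<and> e #> g = e')"
    using flag_transitive by blast
  show "\<forall>v\<in>V. (\<forall>e\<in>mg_edges_at E inc v. \<forall>e'\<in>mg_edges_at E inc v.
          \<exists>g\<in>carrier G. v #> g = v \<and> e #> g = e') \<and>
        (\<exists>c\<in>carrier G. v #> c = v \<and> (\<forall>g\<in>carrier G. v #> g = v \<longrightarrow>
          (\<exists>n::int. \<forall>e\<in>mg_edges_at E inc v. e #> g = e #> (c [^] n))))"
  proof (rule ballI, rule conjI)
    fix v assume v: "v \<in> V"
    show "\<forall>e\<in>mg_edges_at E inc v. \<forall>e'\<in>mg_edges_at E inc v. \<exists>g\<in>carrier G. v #> g = v \<and> e #> g = e'"
      using flag_transitive unfolding mg_edges_at_def by blast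
    show "\<exists>c\<in>carrier G. v #> c = v \<and> (\<forall>g\<in>carrier G. v #> g = v \<longrightarrow>
        (\<exists>n::int. \<forall>e\<in>mg_edges_at E inc v. e #> g = e #> (c [^] n)))"
    proof -
      obtain c where "c \<in> carrier G" "v #> c = v"
        and "\<forall>g\<in>carrier G. v #> g = v \<longrightarrow> (\<exists>n::int. g = c [^] n)"
        using vertex_stabiliser_cyclic[OF assms v] by blast
      then show ?thesis by fastforce
    qed
  qed
qed

lemma not_K2_mult:
  assumes "H \<noteq> Hz"
  shows "\<not> is_K2_mult V E inc lam"
proof
  assume "is_K2_mult V E inc lam"
  then obtain u w where "u \<noteq> w \<and> V = {u, w} \<and> finite E \<and> card E = lam \<and>
      (\<forall>e\<in>E. mg_ends V inc e = {u, w})"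
    unfolding is_K2_mult_def by (elim exE) (rule that)
  then have V_eq: "V = {u, w}" by (elim conjE)
  have H_sub: "H \<subseteq> carrier G" using subgroup.subset[OF subgroup_H] .
  have "H #> \<one> \<in> V" using rcosetsI[OF H_sub one_closed] .
  then have "H \<in> V" using coset_mult_one[OF H_sub] by simp
  have at_most_one: "p = q" if "p \<in> V - {H}" "q \<in> V - {H}" for p q
    using that \<open>H \<in> V\<close> unfolding V_eq by auto
  have other: "H #> (z \<otimes> h) \<in> V - {H}" if h: "h \<in> H" for h
  proof -
    have "H #> (z \<otimes> h) \<in> V" using rcosetsI[OF H_sub] z_carrier H_carrier[OF h] by simp
    moreover have "H #> (z \<otimes> h) \<noteq> H"
      using rcoset_z_mult_neq[OF H_carrier[OF h]] subgroup.rcos_const[OF subgroup_H is_group h]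
      by simp
    ultimately show ?thesis by simp
  qed
  have "z \<otimes> h \<otimes> z \<in> H" if h: "h \<in> H" for h
  proof -
    have "H #> (z \<otimes> h) = H #> (z \<otimes> \<one>)"
      by (rule at_most_one[OF other[OF h] other[OF subgroup.one_closed[OF subgroup_H]]])
    then show ?thesis
      using rcos_eq_iff[OF subgroup_H, of "z \<otimes> h" z] H_carrier[OF h] z_carrier by (simp add: inv_z)
  qed
  then show False using Hz_eq_H_if_conj_closed assms by simp
qed

lemma not_simple_cycle:
  assumes "finite H" "card H \<ge> 3"
  shows "\<not> is_simple_cycle V E inc"
proof
  assume "is_simple_cycle V E inc"
  then have simple: "mg_simple V E inc" and valency_2: "mg_valency V E inc 2"
    unfolding is_simple_cycle_def by auto
  have H_sub: "H \<subseteq> carrier G" using subgroup.subset[OF subgroup_H] .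
  have adj: "mg_adj V E inc H (H #> z)"
    using adj_iff[OF one_closed, of "H #> z"] subgroup.one_closed[OF subgroup_H] H_sub z_carrier
    by force
  then have "H \<in> V" "H #> z \<in> V" "H \<noteq> H #> z" unfolding mg_adj_def by auto
  have "card ((\<lambda>h. K #> h) ` H) = 2"
    using valency_2 \<open>H \<in> V\<close> card_neighbours[OF one_closed] H_sub
    unfolding mg_valency_def by simp
  moreover have "card {e \<in> E. inc H e \<and> inc (H #> z) e} = card K"
    using edge_multiplicity[OF assms(1)] adj unfolding mg_edge_multiplicity_def by blast
  moreover have "card {e \<in> E. inc H e \<and> inc (H #> z) e} \<le> 1"
    using mg_simple_common_edges_card_le_1[OF simple \<open>H \<in> V\<close> \<open>H #> z \<in> V\<close> \<open>H \<noteq> H #> z\<close>] .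
  ultimately show False using card_H_eq_index_times_card_K assms(2) by simp
qed

end

theorem lemma3p2:
  fixes G :: "('g, 'b) monoid_scheme" and a z :: 'g
    and H J Hz :: "'g set" and k lam :: nat
  assumes grp: "group G"
    and a_in: "a \<in> carrier G" and z_in: "z \<in> carrier G"
    and gen: "generate G {a, z} = carrier G"
    and a_fin: "group.ord G a \<noteq> 0"
    and z_ord: "group.ord G z = 2"
    and z_notin: "z \<notin> generate G {a}"
    and H_def: "H = generate G {a}"
    and J_def: "J = generate G {z}"
    and Hz_def: "Hz = (inv\<^bsub>G\<^esub> z) <#\<^bsub>G\<^esub> (H #>\<^bsub>G\<^esub> z)"
    and k_def: "k = card ((\<lambda>h. (H \<inter> Hz) #>\<^bsub>G\<^esub> h) ` H)"
    and lam_def: "lam = card (H \<inter> Hz)"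
  shows "vertex_rotary G (rcosets\<^bsub>G\<^esub> H) (rcosets\<^bsub>G\<^esub> J) (cos_inc G H J)
           (\<lambda>S g. S #>\<^bsub>G\<^esub> g) (\<lambda>T g. T #>\<^bsub>G\<^esub> g)
       \<and> mg_valency (rcosets\<^bsub>G\<^esub> H) (rcosets\<^bsub>G\<^esub> J) (cos_inc G H J) k
       \<and> mg_edge_multiplicity (rcosets\<^bsub>G\<^esub> H) (rcosets\<^bsub>G\<^esub> J) (cos_inc G H J) lam
       \<and> group.ord G a = k * lam
       \<and> (group.ord G a \<ge> 3 \<and> H \<noteq> Hz \<longrightarrow>
            \<not> is_K2_mult (rcosets\<^bsub>G\<^esub> H) (rcosets\<^bsub>G\<^esub> J) (cos_inc G H J) lam
          \<and> \<not> is_simple_cycle (rcosets\<^bsub>G\<^esub> H) (rcosets\<^bsub>G\<^esub> J) (cos_inc G H J))"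
proof -
  interpret group G by (rule grp)
  have "z \<otimes>\<^bsub>G\<^esub> z = \<one>\<^bsub>G\<^esub>"
    using pow_ord_eq_1[OF z_in] z_ord z_in by (simp add: numeral_2_eq_2)
  moreover have "subgroup H G" using H_def a_in by (simp add: generate_is_subgroup)
  ultimately interpret \<Gamma>: involution_coset_graph G H z
    using grp z_in z_notin H_def
    unfolding involution_coset_graph_def involution_coset_graph_axioms_def by blast
  have card_H: "card H = group.ord G a" using generate_pow_card[OF a_in] H_def by simp
  then have "finite H" using a_fin card.infinite by fastforce
  show ?thesis
    unfolding J_def Hz_def k_def lam_def
  proof (intro conjI impI)
    show "vertex_rotary G \<Gamma>.V \<Gamma>.E \<Gamma>.inc (\<lambda>S g. S #>\<^bsub>G\<^esub> g) (\<lambda>T g. T #>\<^bsub>G\<^esub> g)"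
      using \<Gamma>.vertex_rotary_cos_graph[OF a_in H_def] .
    show "mg_valency \<Gamma>.V \<Gamma>.E \<Gamma>.inc (card ((\<lambda>h. \<Gamma>.K #>\<^bsub>G\<^esub> h) ` H))"
      using \<Gamma>.valency[OF \<open>finite H\<close>] .
    show "mg_edge_multiplicity \<Gamma>.V \<Gamma>.E \<Gamma>.inc (card \<Gamma>.K)"
      using \<Gamma>.edge_multiplicity[OF \<open>finite H\<close>] .
    show "group.ord G a = card ((\<lambda>h. \<Gamma>.K #>\<^bsub>G\<^esub> h) ` H) * card \<Gamma>.K"
      using \<Gamma>.card_H_eq_index_times_card_K card_H by simp
  next
    assume "3 \<le> group.ord G a \<and> H \<noteq> \<Gamma>.Hz"
    then show "\<not> is_K2_mult \<Gamma>.V \<Gamma>.E \<Gamma>.inc (card \<Gamma>.K)" and "\<not> is_simple_cycle \<Gamma>.V \<Gamma>.E \<Gamma>.inc"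
      using \<Gamma>.not_K2_mult \<Gamma>.not_simple_cycle[OF \<open>finite H\<close>] card_H by simp_all
  qed
qed

end
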